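(* Let $\tilde p$ be the estimator returned by the algorithm "Idealised Splitting with Coupling" (defined in the context), run with initial distribution $\lambda$, initial number of particles $N_0\ge 1$ and splitting ratios $R_1,\dots,R_{m-1}$, and let $p=\mathbb{P}(\tau_B<\tau_A)$ where $X(0)\sim\lambda$. Then $\tilde p$ is an unbiased estimator for $p$, that is, $$\mathbb{E}[\tilde p]=p .$$
   Context: **Process.** $X=(X(t):t\ge 0)$ is a diffusion in $\mathbb{R}^d$, the strong solution of $dX(t)=\mu(X(t))\,dt+\sigma(X(t))\,dW(t)$, $X(0)\sim\lambda$, where $W$ is an $e$-dimensional Brownian motion, and $\mu:\mathbb{R}^d\to\mathbb{R}^d$, $\sigma:\mathbb{R}^d\to\mathbb{R}^{d\times e}$ are sufficiently regular to guarantee existence of a strong It\^o solution. So $X$ is Markov with almost surely continuous paths. The volatility is assumed bounded away from $0$, so that $X$ crosses any given boundary with positive probability over any time interval. **Sets and levels.** $\xi:\mathbb{R}^d\to\mathbb{R}$ is continuous, $z_A<z_1<z_2<\dots<z_m=z_B$ are reals, $A=\xi^{-1}((-\infty,z_A])$, $B_i=\xi^{-1}([z_i,\infty))$ for $i=1,\dots,m$, and $B=B_m$. The set $A$ is positive recurrent for $X$. The support of $\lambda$ is contained in $\xi^{-1}([z_A,z_B])$. Write $\tau_S$ for the first hitting time of a set $S$ by $X$, $\tau_i=\tau_{B_i}$, and $\sigma_i=\tau_A\wedge\tau_i$. **Delayed times.** Fix $T>0$. With $\mathbb{N}=\{1,2,\dots\}$, put $\tilde\sigma_i=T\cdot\min\{n\in\mathbb{N}: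 nT\ge\sigma_i\}$, and let $\tilde\tau_i$ be the corresponding upper bound for $\tau_i$, $\tilde\tau_i=T\cdot\min\{n\in\mathbb{N}:nT\ge\tau_i\}$. **$\varepsilon$-strong sampler.** $\tilde X$ denotes an approximating path of $X$ produced by an $\varepsilon$-strong algorithm: on an interval $[s,t]$, such an algorithm is a joint construction, on one probability space, of $X$ and of processes $\tilde X^{\varepsilon}$, $\varepsilon>0$, such that (1) almost surely $\sup_{r\in[s,t]}\|X(r)-\tilde X^\varepsilon(r)\|\le\varepsilon$ for an appropriate norm $\|\cdot\|$; (2) $\tilde X^\varepsilon$ is piecewise constant with finitely many values; (3) $\tilde X^\varepsilon$ can be simulated exactly; (4) for $\varepsilon'<\varepsilon$, almost surely for all $r\in[s,t]$ the closed ball of radius $\varepsilon'$ about $\tilde X^{\varepsilon'}(r)$ is contained in the closed ball of radius $\varepsilon$ about $\tilde X^{\varepsilon}(r)$, and $\tilde X^{\varepsilon'}$ can be sampled conditionally on $\tilde X^{\varepsilon}$. It is assumed that the end-points of $\varepsilon$-strong samples are from the true distribution of $X$: over any $[s,t]$, $(\tilde X(t)\mid\tilde X(s)=x_s)$ is equal in distribution to $(X(t)\mid X(s)=x_s)$. Thus the end-point value $\tilde X(\tilde\sigma_i)$ below is the value $X(\tilde\sigma_i)$ of the underlying path. **Quadruple process.** For $i=1,\dots,m$ let $V_i=(\sigma_i,\tilde\sigma_i,X(\sigma_i),\tilde X(\tilde\sigma_i))$, with $V_0=(0,0,X(0),X(0))$. Let $\tilde M_i$ be the Markov transition kernel of this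 discrete-time process from $V_{i-1}$ to $V_i$, and let $\tilde G_i(V_i)=1$ if $X(\sigma_i)\in B_i$ and $\tilde G_i(V_i)=0$ otherwise. **Idealised Splitting with Coupling.** Inputs: $\lambda$, $\tilde G_i,\tilde M_i$ ($i=1,\dots,m$), $N_0\ge 1$, and fixed positive integers $R_1,\dots,R_{m-1}$. 1. Independently for $j=1,\dots,N_0$, draw $X_1^j(0)\sim\lambda$ and $V_1^j\sim\tilde M_1((0,0,X_1^j(0),X_1^j(0)),\cdot)$. 2. Let $S_1$ be the list of those $V_1^j$ with $\tilde G_1(V_1^j)=1$, and $N_1=|S_1|$. 3. For $i=2,\dots,m$: if $N_{i-1}=0$, return $\tilde p=0$. Otherwise, writing $S_{i-1}=\{V_{i-1}^j\}_{j=1}^{N_{i-1}}$, for each $1\le j\le N_{i-1}$ and $1\le k\le R_{i-1}$ sample $V_i^{(j,k)}\sim\tilde M_i(V_{i-1}^j,\cdot)$; let $S_i$ be the list of those $V_i^{(j,k)}$ with $\tilde G_i(V_i^{(j,k)})=1$, and $N_i=|S_i|$. 4. Return $\tilde p=\dfrac{N_m}{N_0\prod_{i=1}^{m-1}R_i}$. The copies in step 3 are not independent but are coupled as follows. Each particle carries a full path of $X$. When a path first reaches $B_i$ before $A$ (at time $\tau_i$), $i\le m-1$, it is replaced by $R_i$ copies; these copies are identically equal from time $\tau_i$ until time $\tilde\tau_i$, and after $\tilde\tau_i$ they evolve conditionally independently given $X(\tilde\tau_i)$, each as the diffusion $X$. If a path crosses several levels $z_i,z_{i+1},\dots$ before time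 $\tilde\tau_i$, it splits at each of them, all the resulting copies staying identical until $\tilde\tau_i$ and proceeding conditionally independently afterwards. Particles descending from different initial particles are independent. *)

theory Defs
  imports "HOL-Probability.Probability"
begin

section \<open>Paths, hitting times and delayed times\<close>

text \<open>
  A path is a function of type \<open>real \<Rightarrow> 'a\<close> of which only the restriction to \<open>{0..}\<close> matters.
  Random times take values in \<^typ>\<open>ennreal\<close>, so that a set which is never reached is reached at
  time \<open>\<infinity>\<close>. All laws of paths are laws on the cylinder sigma-algebra.
\<close>

definition path_algebra :: "(real \<Rightarrow> 'a::topological_space) measure" where
  "path_algebra = (\<Pi>\<^sub>M t\<in>{0..}. borel)"

definition path_law :: "'w measure \<Rightarrow> ('w \<Rightarrow> real \<Rightarrow> 'a::topological_space) \<Rightarrow> (real \<Rightarrow> 'a) measure" where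
  "path_law M X = distr M path_algebra (\<lambda>\<omega>. restrict (X \<omega>) {0..})"

definition continuous_process :: "'w measure \<Rightarrow> ('w \<Rightarrow> real \<Rightarrow> 'a::topological_space) \<Rightarrow> bool" where
  "continuous_process M X \<longleftrightarrow>
     (\<forall>t\<ge>0. (\<lambda>\<omega>. X \<omega> t) \<in> borel_measurable M) \<and>
     (AE \<omega> in M. continuous_on {0..} (X \<omega>))"

definition hitting_time :: "'a set \<Rightarrow> (real \<Rightarrow> 'a) \<Rightarrow> ennreal" where
  "hitting_time S x = (INF t\<in>{t. 0 \<le> t \<and> x t \<in> S}. ennreal t)"

text \<open>The first grid point \<open>n T\<close> with \<open>n \<ge> 1\<close> which is not before \<open>s\<close>.\<close>

definition delay :: "real \<Rightarrow> ennreal \<Rightarrow> ennreal" where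
  "delay T s =
     (if s = \<infinity> then \<infinity> else ennreal (T * real (LEAST n. 1 \<le> n \<and> s \<le> ennreal (real n * T))))"

text \<open>The value \<open>x 0\<close> given by the next definition at \<open>s = \<infinity>\<close> is a dummy.\<close>

definition value_at :: "(real \<Rightarrow> 'a) \<Rightarrow> ennreal \<Rightarrow> 'a" where
  "value_at x s = x (enn2real s)"

definition stopped :: "ennreal \<Rightarrow> (real \<Rightarrow> 'a) \<Rightarrow> real \<Rightarrow> 'a" where
  "stopped s x = (\<lambda>t\<in>{0..}. if ennreal t \<le> s then x t else value_at x s)"

definition shifted :: "ennreal \<Rightarrow> (real \<Rightarrow> 'a) \<Rightarrow> real \<Rightarrow> 'a" where
  "shifted s x = (\<lambda>t\<in>{0..}. x (enn2real s + t))"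

section \<open>Stochastic differential equations\<close>

text \<open>
  The filtration generated by the initial value \<open>\<zeta>\<close> and the noise \<open>W\<close>, augmented by the null sets.
\<close>

definition noise_filtration ::
  "'w measure \<Rightarrow> ('w \<Rightarrow> 'a::topological_space) \<Rightarrow> ('w \<Rightarrow> real \<Rightarrow> 'b::topological_space)
     \<Rightarrow> real \<Rightarrow> 'w measure" where
  "noise_filtration M \<zeta> W t =
     sigma (space M)
       ({\<zeta> -` A \<inter> space M | A. A \<in> sets borel} \<union>
        {(\<lambda>\<omega>. W \<omega> s) -` A \<inter> space M | s A. 0 \<le> s \<and> s \<le> t \<and> A \<in> sets borel} \<union>
        null_sets M)"

definition brownian_motion ::
  "'w measure \<Rightarrow> (real \<Rightarrow> 'w measure) \<Rightarrow> ('w \<Rightarrow> real \<Rightarrow> real ^ 'e) \<Rightarrow> bool" where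
  "brownian_motion M F W \<longleftrightarrow>
     (\<forall>t\<ge>0. subalgebra M (F t) \<and> (\<lambda>\<omega>. W \<omega> t) \<in> borel_measurable (F t)) \<and>
     (AE \<omega> in M. W \<omega> 0 = 0) \<and>
     (AE \<omega> in M. continuous_on {0..} (W \<omega>)) \<and>
     (\<forall>s t. 0 \<le> s \<and> s < t \<longrightarrow>
        distributed M lborel (\<lambda>\<omega>. W \<omega> t - W \<omega> s)
          (\<lambda>x. ennreal (\<Prod>i\<in>UNIV. normal_density 0 (sqrt (t - s)) (x $ i))) \<and>
        prob_space.indep_set M (sets (F s))
          {(\<lambda>\<omega>. W \<omega> t - W \<omega> s) -` A \<inter> space M | A. A \<in> sets borel})"

text \<open>
  A simple integrand is \<open>\<Sum>k<n. c k\<close> on \<open>(tm k, tm (Suc k)]\<close> with \<open>c k\<close> bounded and measurable at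
  time \<open>tm k\<close>.
\<close>

definition simple_integrand ::
  "'w measure \<Rightarrow> (real \<Rightarrow> 'w measure) \<Rightarrow> nat \<Rightarrow> (nat \<Rightarrow> real) \<Rightarrow> (nat \<Rightarrow> 'w \<Rightarrow> real ^ 'e ^ 'd) \<Rightarrow> bool" where
  "simple_integrand M F n tm c \<longleftrightarrow>
     0 \<le> tm 0 \<and>
     (\<forall>k<n. tm k < tm (Suc k) \<and> c k \<in> borel_measurable (F (tm k)) \<and>
        (\<exists>b. \<forall>\<omega>\<in>space M. norm (c k \<omega>) \<le> b))"

definition simple_process ::
  "nat \<Rightarrow> (nat \<Rightarrow> real) \<Rightarrow> (nat \<Rightarrow> 'w \<Rightarrow> real ^ 'e ^ 'd) \<Rightarrow> 'w \<Rightarrow> real \<Rightarrow> real ^ 'e ^ 'd" where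
  "simple_process n tm c \<omega> t = (\<Sum>k<n. indicator {tm k<..tm (Suc k)} t *\<^sub>R c k \<omega>)"

definition simple_integral ::
  "('w \<Rightarrow> real \<Rightarrow> real ^ 'e) \<Rightarrow> nat \<Rightarrow> (nat \<Rightarrow> real) \<Rightarrow> (nat \<Rightarrow> 'w \<Rightarrow> real ^ 'e ^ 'd)
     \<Rightarrow> 'w \<Rightarrow> real \<Rightarrow> real ^ 'd" where
  "simple_integral W n tm c \<omega> t =
     (\<Sum>k<n. c k \<omega> *v (W \<omega> (min t (tm (Suc k))) - W \<omega> (min t (tm k))))"

text \<open>
  \<open>I\<close> is the Ito integral process of \<open>H\<close> against \<open>W\<close>: the continuous adapted process which is the
  limit in probability of the integrals of simple integrands approximating \<open>H\<close> in
  \<open>L\<^sup>2([0,t])\<close> in probability for every \<open>t\<close>. Such an approximation exists only if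
  \<open>\<integral>\<^sub>0\<^sup>t norm (H s)\<^sup>2 ds < \<infinity>\<close> almost surely.
\<close>

definition ito_integral ::
  "'w measure \<Rightarrow> (real \<Rightarrow> 'w measure) \<Rightarrow> ('w \<Rightarrow> real \<Rightarrow> real ^ 'e)
     \<Rightarrow> ('w \<Rightarrow> real \<Rightarrow> real ^ 'e ^ 'd) \<Rightarrow> ('w \<Rightarrow> real \<Rightarrow> real ^ 'd) \<Rightarrow> bool" where
  "ito_integral M F W H I \<longleftrightarrow>
     (\<forall>t\<ge>0. (\<lambda>\<omega>. I \<omega> t) \<in> borel_measurable (F t)) \<and>
     (AE \<omega> in M. continuous_on {0..} (I \<omega>)) \<and>
     (\<exists>n tm c.
        (\<forall>j. simple_integrand M F (n j) (tm j) (c j)) \<and>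
        (\<forall>t\<ge>0. \<forall>\<delta>>0.
           (\<lambda>j::nat. measure M {\<omega> \<in> space M. ennreal \<delta> <
              (\<integral>\<^sup>+s\<in>{0..t}. ennreal ((norm (H \<omega> s - simple_process (n j) (tm j) (c j) \<omega> s))\<^sup>2) \<partial>lborel)})
             \<longlonglongrightarrow> 0) \<and>
        (\<forall>t\<ge>0. \<forall>\<delta>>0.
           (\<lambda>j. measure M {\<omega> \<in> space M.
              \<delta> < norm (I \<omega> t - simple_integral W (n j) (tm j) (c j) \<omega> t)})
             \<longlonglongrightarrow> 0))"

text \<open>
  Strong solution of \<open>dX = \<mu>(X) dt + \<sigma>(X) dW\<close>: \<open>W\<close> is a Brownian motion independent of \<open>X 0\<close>,
  and \<open>X\<close> is adapted to the augmented filtration generated by \<open>X 0\<close> and \<open>W\<close>.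
\<close>

definition strong_solution ::
  "'w measure \<Rightarrow> ('w \<Rightarrow> real \<Rightarrow> real ^ 'e) \<Rightarrow> (real ^ 'd \<Rightarrow> real ^ 'd)
     \<Rightarrow> (real ^ 'd \<Rightarrow> real ^ 'e ^ 'd) \<Rightarrow> ('w \<Rightarrow> real \<Rightarrow> real ^ 'd) \<Rightarrow> bool" where
  "strong_solution M W \<mu> \<sigma> X \<longleftrightarrow>
     (let F = noise_filtration M (\<lambda>\<omega>. X \<omega> 0) W in
        brownian_motion M F W \<and>
        (\<forall>t\<ge>0. (\<lambda>\<omega>. X \<omega> t) \<in> borel_measurable (F t)) \<and>
        continuous_process M X \<and>
        (\<exists>I. ito_integral M F W (\<lambda>\<omega> t. \<sigma> (X \<omega> t)) I \<and>
           (AE \<omega> in M. \<forall>t\<ge>0.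
              set_integrable lborel {0..t} (\<lambda>s. \<mu> (X \<omega> s)) \<and>
              X \<omega> t = X \<omega> 0 + (LINT s:{0..t}|lborel. \<mu> (X \<omega> s)) + I \<omega> t)))"

text \<open>
  The Markov property of \<open>X\<close>: given the past up to \<open>t\<close>, the path after \<open>t\<close> has law \<open>P (X t)\<close>.
\<close>

definition markov_process ::
  "'w measure \<Rightarrow> (real \<Rightarrow> 'w measure) \<Rightarrow> ('a::topological_space \<Rightarrow> (real \<Rightarrow> 'a) measure)
     \<Rightarrow> ('w \<Rightarrow> real \<Rightarrow> 'a) \<Rightarrow> bool" where
  "markov_process M F P X \<longleftrightarrow>
     P \<in> borel \<rightarrow>\<^sub>M prob_algebra path_algebra \<and>
     (\<forall>t\<ge>0. \<forall>C\<in>sets (F t). \<forall>E\<in>sets path_algebra.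
        measure M {\<omega> \<in> C. shifted (ennreal t) (X \<omega>) \<in> E} =
        (LINT \<omega>:C|M. measure (P (X \<omega> t)) E))"

text \<open>\<open>Y x\<close> is the process started at \<open>x\<close>.\<close>

definition positive_recurrent ::
  "'w measure \<Rightarrow> ('a \<Rightarrow> 'w \<Rightarrow> real \<Rightarrow> 'a) \<Rightarrow> 'a set \<Rightarrow> bool" where
  "positive_recurrent M Y A \<longleftrightarrow> (\<forall>x. (\<integral>\<^sup>+\<omega>. hitting_time A (Y x \<omega>) \<partial>M) < \<infinity>)"

definition support :: "'a::topological_space measure \<Rightarrow> 'a set" where
  "support \<nu> = {x. \<forall>U. open U \<and> x \<in> U \<longrightarrow> 0 < emeasure \<nu> U}"

section \<open>Epsilon-strong sampling\<close>

definition is_norm :: "('a::real_vector \<Rightarrow> real) \<Rightarrow> bool" where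
  "is_norm nrm \<longleftrightarrow>
     (\<forall>x. nrm x = 0 \<longleftrightarrow> x = 0) \<and> (\<forall>c x. nrm (c *\<^sub>R x) = \<bar>c\<bar> * nrm x) \<and>
     (\<forall>x y. nrm (x + y) \<le> nrm x + nrm y)"

text \<open>The set \<open>Q\<close> consists of the end-points of the pieces.\<close>

definition piecewise_constant_on :: "real \<Rightarrow> real \<Rightarrow> (real \<Rightarrow> 'a) \<Rightarrow> bool" where
  "piecewise_constant_on s t x \<longleftrightarrow>
     (\<exists>Q. finite Q \<and> (\<forall>a b. s \<le> a \<and> a \<le> b \<and> b \<le> t \<and> {a..b} \<inter> Q = {} \<longrightarrow> x a = x b))"

text \<open>
  \<open>Xt \<epsilon>\<close> is the approximation of \<open>X\<close> with accuracy \<open>\<epsilon>\<close>. The last conjunct says that the samples are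
  exact at the end-points.
\<close>

definition eps_strong_sampler ::
  "'w measure \<Rightarrow> ('a::{real_vector, topological_space} \<Rightarrow> real) \<Rightarrow> real \<Rightarrow> real
     \<Rightarrow> ('w \<Rightarrow> real \<Rightarrow> 'a) \<Rightarrow> (real \<Rightarrow> 'w \<Rightarrow> real \<Rightarrow> 'a) \<Rightarrow> bool" where
  "eps_strong_sampler M nrm s t X Xt \<longleftrightarrow>
     (\<forall>\<epsilon>>0. \<forall>r\<in>{s..t}. (\<lambda>\<omega>. Xt \<epsilon> \<omega> r) \<in> borel_measurable M) \<and>
     (\<forall>\<epsilon>>0. AE \<omega> in M. \<forall>r\<in>{s..t}. nrm (X \<omega> r - Xt \<epsilon> \<omega> r) \<le> \<epsilon>) \<and>
     (\<forall>\<epsilon>>0. AE \<omega> in M. piecewise_constant_on s t (Xt \<epsilon> \<omega>)) \<and>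
     (\<forall>\<epsilon> \<epsilon>'. 0 < \<epsilon>' \<and> \<epsilon>' < \<epsilon> \<longrightarrow>
        (AE \<omega> in M. \<forall>r\<in>{s..t}.
           {y. nrm (y - Xt \<epsilon>' \<omega> r) \<le> \<epsilon>'} \<subseteq> {y. nrm (y - Xt \<epsilon> \<omega> r) \<le> \<epsilon>})) \<and>
     (\<forall>\<epsilon>>0. AE \<omega> in M. Xt \<epsilon> \<omega> s = X \<omega> s \<and> Xt \<epsilon> \<omega> t = X \<omega> t)"

section \<open>Levels and the quadruple process\<close>

definition lower_set :: "('a \<Rightarrow> real) \<Rightarrow> real \<Rightarrow> 'a set" where
  "lower_set \<xi> zA = \<xi> -` {..zA}"

definition upper_set :: "('a \<Rightarrow> real) \<Rightarrow> (nat \<Rightarrow> real) \<Rightarrow> nat \<Rightarrow> 'a set" where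
  "upper_set \<xi> z i = \<xi> -` {z i..}"

definition exit_time :: "('a \<Rightarrow> real) \<Rightarrow> real \<Rightarrow> (nat \<Rightarrow> real) \<Rightarrow> nat \<Rightarrow> (real \<Rightarrow> 'a) \<Rightarrow> ennreal" where
  "exit_time \<xi> zA z i x =
     min (hitting_time (lower_set \<xi> zA) x) (hitting_time (upper_set \<xi> z i) x)"

type_synonym 'a quadruple = "ennreal \<times> ennreal \<times> 'a \<times> 'a"

definition quadruple ::
  "('a \<Rightarrow> real) \<Rightarrow> real \<Rightarrow> (nat \<Rightarrow> real) \<Rightarrow> real \<Rightarrow> nat \<Rightarrow> (real \<Rightarrow> 'a) \<Rightarrow> (real \<Rightarrow> 'a) \<Rightarrow> 'a quadruple" where
  "quadruple \<xi> zA z T i x xt =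
     (if i = 0 then (0, 0, x 0, x 0)
      else let s = exit_time \<xi> zA z i x
           in (s, delay T s, value_at x s, value_at xt (delay T s)))"

definition potential :: "('a \<Rightarrow> real) \<Rightarrow> (nat \<Rightarrow> real) \<Rightarrow> nat \<Rightarrow> 'a quadruple \<Rightarrow> nat" where
  "potential \<xi> z i = (\<lambda>(s, st, y, yt). if y \<in> upper_set \<xi> z i then 1 else 0)"

text \<open>
  \<open>K\<close> is a version of the Markov transition kernel of \<open>V\<close> from \<open>V (i - 1)\<close> to \<open>V i\<close>, for \<open>i \<ge> 1\<close>.
\<close>

definition transition_kernel ::
  "'w measure \<Rightarrow> (nat \<Rightarrow> 'w \<Rightarrow> 'v::topological_space) \<Rightarrow> nat \<Rightarrow> ('v \<Rightarrow> 'v measure) \<Rightarrow> bool" where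
  "transition_kernel M V i K \<longleftrightarrow>
     K \<in> borel \<rightarrow>\<^sub>M prob_algebra borel \<and>
     (\<forall>h\<le>i. V h \<in> borel_measurable M) \<and>
     (\<forall>C D. (\<forall>h<i. C h \<in> sets borel) \<and> D \<in> sets borel \<longrightarrow>
        measure M {\<omega> \<in> space M. (\<forall>h<i. V h \<omega> \<in> C h) \<and> V i \<omega> \<in> D} =
        (LINT \<omega>:{\<omega> \<in> space M. \<forall>h<i. V h \<omega> \<in> C h}|M. measure (K (V (i - 1) \<omega>)) D))"

section \<open>Idealised splitting with coupling\<close>

text \<open>
  Particles are named by lists: \<open>[j]\<close> is the \<open>j\<close>-th initial particle and \<open>u @ [k]\<close> the \<open>k\<close>-th copy
  of \<open>u\<close>, so that a particle of stage \<open>i\<close> has a name of length \<open>i\<close>; the empty list is the common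
  root, with \<open>N0\<close> children. Particle \<open>u\<close> carries the path \<open>Z u\<close> and its approximation \<open>Zt u\<close>. Names
  which do not occur in a run carry irrelevant paths.
\<close>

locale splitting_run =
  fixes \<xi> :: "real ^ 'd \<Rightarrow> real" and zA :: real and z :: "nat \<Rightarrow> real" and T :: real
    and m :: nat and N0 :: nat and R :: "nat \<Rightarrow> nat"
    and Z :: "nat list \<Rightarrow> 'v \<Rightarrow> real \<Rightarrow> real ^ 'd"
    and Zt :: "nat list \<Rightarrow> 'v \<Rightarrow> real \<Rightarrow> real ^ 'd"
begin

definition V :: "nat \<Rightarrow> nat list \<Rightarrow> 'v \<Rightarrow> (real ^ 'd) quadruple" where
  "V i u \<omega> = quadruple \<xi> zA z T i (Z u \<omega>) (Zt u \<omega>)"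

definition copies :: "nat \<Rightarrow> nat" where
  "copies i = (if i = 0 then N0 else R i)"

definition offspring :: "nat \<Rightarrow> nat list list \<Rightarrow> nat list list" where
  "offspring i us = [u @ [k]. u \<leftarrow> us, k \<leftarrow> [0..<copies i]]"

text \<open>\<open>survivors i\<close> is the list \<open>S\<^sub>i\<close>, as a list of names.\<close>

primrec survivors :: "nat \<Rightarrow> 'v \<Rightarrow> nat list list" where
  "survivors 0 \<omega> = [[]]"
| "survivors (Suc i) \<omega> =
     filter (\<lambda>u. potential \<xi> z (Suc i) (V (Suc i) u \<omega>) = 1) (offspring i (survivors i \<omega>))"

text \<open>The particles sampled at stage \<open>i \<ge> 1\<close>, before selection.\<close>

definition sampled :: "nat \<Rightarrow> 'v \<Rightarrow> nat list list" where
  "sampled i \<omega> = offspring (i - 1) (survivors (i - 1) \<omega>)"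

definition survivor_count :: "nat \<Rightarrow> 'v \<Rightarrow> nat" where
  "survivor_count i \<omega> = length (survivors i \<omega>)"

definition estimator :: "'v \<Rightarrow> real" where
  "estimator \<omega> =
     (if \<exists>i\<in>{2..m}. survivor_count (i - 1) \<omega> = 0 then 0
      else real (survivor_count m \<omega>) / (real N0 * (\<Prod>i\<in>{1..m - 1}. real (R i))))"

definition delayed_exit :: "nat \<Rightarrow> nat list \<Rightarrow> 'v \<Rightarrow> ennreal" where
  "delayed_exit i u \<omega> = delay T (exit_time \<xi> zA z i (Z u \<omega>))"

definition delayed_hit :: "nat \<Rightarrow> nat list \<Rightarrow> 'v \<Rightarrow> ennreal" where
  "delayed_hit i u \<omega> = delay T (hitting_time (upper_set \<xi> z i) (Z u \<omega>))"

end

text \<open>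
  \<open>PX\<close> is the law of the diffusion started from its initial distribution, \<open>P x\<close> its law when started at \<open>x\<close>, and \<open>K i\<close>
  the transition kernel into stage \<open>i\<close>. The sampling rules (\<open>stage_one\<close>, \<open>later_stages\<close>) describe the
  law of one particle given its parent's quadruple; the joint law is given by \<open>initial_independent\<close>
  and by the coupling (\<open>identical_until\<close>, \<open>independent_after\<close>).

  In \<open>independent_after\<close> the conditioning is on all paths sampled up to stage \<open>i\<close>, each of them
  stopped at its own delayed exit time; events of this form are an intersection-stable generator.
  The copies of distinct survivors are conditionally independent as well, which together with
  \<open>initial_independent\<close> makes the descendants of distinct initial particles independent.
\<close>

locale coupled_splitting =
  splitting_run \<xi> zA z T m N0 R Z "\<lambda>u. Zt u eps" + prob_space N + complete_measure N
  for \<xi> :: "real ^ 'd \<Rightarrow> real" and zA :: real and z :: "nat \<Rightarrow> real" and T :: real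
    and m :: nat and N0 :: nat and R :: "nat \<Rightarrow> nat"
    and Z :: "nat list \<Rightarrow> 'v \<Rightarrow> real \<Rightarrow> real ^ 'd"
    and Zt :: "nat list \<Rightarrow> real \<Rightarrow> 'v \<Rightarrow> real \<Rightarrow> real ^ 'd"
    and eps :: real and N :: "'v measure" +
  fixes nrm :: "real ^ 'd \<Rightarrow> real"
    and PX :: "(real \<Rightarrow> real ^ 'd) measure"
    and P :: "real ^ 'd \<Rightarrow> (real \<Rightarrow> real ^ 'd) measure"
    and K :: "nat \<Rightarrow> (real ^ 'd) quadruple \<Rightarrow> (real ^ 'd) quadruple measure"
  assumes continuous_paths: "\<And>u. continuous_process N (Z u)"
    and eps_strong: "\<And>u n. eps_strong_sampler N nrm (real n * T) (real (Suc n) * T) (Z u) (Zt u)"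
    and initial_law: "\<And>j. j < N0 \<Longrightarrow> path_law N (Z [j]) = PX"
    and initial_independent:
      "indep_vars (\<lambda>_. path_algebra) (\<lambda>j \<omega>. restrict (Z [j] \<omega>) {0..}) {..<N0}"
    and stage_one:
      "\<And>j C D. j < N0 \<Longrightarrow> C \<in> sets borel \<Longrightarrow> D \<in> sets borel \<Longrightarrow>
         measure N {\<omega> \<in> space N. V 0 [j] \<omega> \<in> C \<and> V 1 [j] \<omega> \<in> D} =
         (LINT \<omega>:{\<omega> \<in> space N. V 0 [j] \<omega> \<in> C}|N. measure (K 1 (V 0 [j] \<omega>)) D)"
    and later_stages:
      "\<And>i u k C D. i \<in> {2..m} \<Longrightarrow> k < R (i - 1) \<Longrightarrow> C \<in> sets borel \<Longrightarrow> D \<in> sets borel \<Longrightarrow>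
         measure N {\<omega> \<in> space N. u \<in> set (survivors (i - 1) \<omega>) \<and> V (i - 1) u \<omega> \<in> C \<and>
           V i (u @ [k]) \<omega> \<in> D} =
         (LINT \<omega>:{\<omega> \<in> space N. u \<in> set (survivors (i - 1) \<omega>) \<and> V (i - 1) u \<omega> \<in> C}|N.
            measure (K i (V (i - 1) u \<omega>)) D)"
    and identical_until:
      "\<And>i. i \<in> {1..<m} \<Longrightarrow>
         AE \<omega> in N. \<forall>u\<in>set (survivors i \<omega>). \<forall>k<R i. \<forall>t\<ge>0.
           ennreal t \<le> delayed_hit i u \<omega> \<longrightarrow> Z (u @ [k]) \<omega> t = Z u \<omega> t"
    and independent_after:
      "\<And>i D E. i \<in> {1..<m} \<Longrightarrow> (\<And>v. D v \<in> sets path_algebra) \<Longrightarrow>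
         (\<And>u k. E u k \<in> sets path_algebra) \<Longrightarrow>
         measure N {\<omega> \<in> space N.
           (\<forall>h\<in>{1..i}. \<forall>v\<in>set (sampled h \<omega>). stopped (delayed_exit h v \<omega>) (Z v \<omega>) \<in> D v) \<and>
           (\<forall>u\<in>set (survivors i \<omega>). \<forall>k<R i. shifted (delayed_hit i u \<omega>) (Z (u @ [k]) \<omega>) \<in> E u k)} =
         (LINT \<omega>:{\<omega> \<in> space N.
           \<forall>h\<in>{1..i}. \<forall>v\<in>set (sampled h \<omega>). stopped (delayed_exit h v \<omega>) (Z v \<omega>) \<in> D v}|N.
           (\<Prod>u\<in>set (survivors i \<omega>). \<Prod>k<R i.
              measure (P (value_at (Z u \<omega>) (delayed_hit i u \<omega>))) (E u k)))"

end

theory Submission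
  imports Defs
begin

text \<open>
  Unbiasedness is linearity of expectation. Name all particles that can possibly occur by lists
  \<open>u\<close>; there are \<open>N0 * R 1 * \<dots> * R (m - 1)\<close> names of length \<open>m\<close>, which is exactly the normalising
  constant of the estimator. Hence the estimator is the average, over these names, of the indicators
  that \<open>u\<close> is present after the last selection, and it suffices that each such indicator has
  expectation \<open>p\<close>. The expectation of a sum depends on the laws of its summands and not on their joint
  law, so whatever the coupling of the copies, only the law of a single ancestral line enters.

  Along one line, the quadruples start with the law of the quadruple of \<open>X\<close> at time \<open>0\<close> and move by
  the same kernels \<open>K i\<close> as the quadruples of \<open>X\<close>. By induction on the stage, the quadruple of a
  particle \<open>u\<close>, restricted to the event that \<open>u\<close> survives, has the same law as the quadruple of
  \<open>X\<close>, restricted to the event that all potentials up to that stage equal \<open>1\<close> (\<open>survivor_law\<close>). So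
  \<open>u\<close> survives all \<open>m\<close> stages with the probability that all \<open>m\<close> potentials of \<open>X\<close> equal \<open>1\<close>.

  For a continuous path the potential of level \<open>i\<close> equals \<open>1\<close> exactly when the path reaches
  \<open>upper_set \<xi> z i\<close> strictly before \<open>lower_set \<xi> zA\<close> (\<open>potential_quadruple_eq_1_iff\<close>), and the upper
  sets are nested, so that all potentials equal \<open>1\<close> if and only if the last one does.

  The sampling rules of the algorithm speak of measures of sets, so the induction needs the
  quadruples to be measurable (\<open>borel_measurable_quadruple\<close>). This amounts to measurability of hitting
  times of sublevel sets of continuous functions by continuous paths, and of the value of the path
  at such a time; completeness of the measure covers paths which are only almost surely continuous.
\<close>

section \<open>Hitting times of closed sets\<close>

lemma hitting_time_le: "0 \<le> t \<Longrightarrow> x t \<in> S \<Longrightarrow> hitting_time S x \<le> ennreal t"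
  unfolding hitting_time_def by (rule INF_lower) auto

lemma hitting_time_attained:
  assumes x: "continuous_on {0..} x" and S: "closed S" and fin: "hitting_time S x < \<infinity>"
  obtains t where "0 \<le> t" "hitting_time S x = ennreal t" "x t \<in> S"
proof -
  define H where "H = {0..} \<inter> x -` S"
  have ne: "H \<noteq> {}"
  proof
    assume "H = {}"
    then have none: "{t. 0 \<le> t \<and> x t \<in> S} = {}" by (auto simp: H_def)
    show False using fin unfolding hitting_time_def none by simp
  qed
  have "closed H" unfolding H_def by (intro continuous_closed_preimage x S) simp
  have bdd: "bdd_below H" by (auto simp: H_def bdd_below_def)
  have inH: "Inf H \<in> H" by (rule closed_contains_Inf[OF ne bdd \<open>closed H\<close>])
  have "hitting_time S x = ennreal (Inf H)"
  proof (rule antisym)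
    show "hitting_time S x \<le> ennreal (Inf H)" using inH by (intro hitting_time_le) (auto simp: H_def)
    show "ennreal (Inf H) \<le> hitting_time S x"
      unfolding hitting_time_def using bdd
      by (intro INF_greatest ennreal_leI cInf_lower) (auto simp: H_def)
  qed
  with inH show thesis by (intro that[of "Inf H"]) (auto simp: H_def)
qed

lemma hitting_time_le_iff:
  assumes "continuous_on {0..} x" "closed S" "0 \<le> t"
  shows "hitting_time S x \<le> ennreal t \<longleftrightarrow> (\<exists>s\<in>{0..t}. x s \<in> S)"
proof
  assume le: "hitting_time S x \<le> ennreal t"
  then have "hitting_time S x < \<infinity>" by (simp add: le_less_trans)
  then obtain s where "0 \<le> s" "hitting_time S x = ennreal s" "x s \<in> S"
    using hitting_time_attained assms by blast
  with le assms(3) show "\<exists>s\<in>{0..t}. x s \<in> S" by auto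
next
  assume "\<exists>s\<in>{0..t}. x s \<in> S"
  then obtain s where "0 \<le> s" "s \<le> t" "x s \<in> S" by auto
  then show "hitting_time S x \<le> ennreal t"
    using hitting_time_le[of s x S] by (meson ennreal_leI order_trans)
qed

text \<open>
  This turns the uncountable quantifier over \<open>s\<close> into countable ones. Truncating the rationals to
  \<open>{0..t}\<close> produces a dense subset of the interval which still contains its end-points. The converse
  direction uses that \<open>g\<close> attains its minimum on the compact interval.
\<close>

lemma attains_sublevel_iff_rationals:
  fixes g :: "real \<Rightarrow> real"
  assumes g: "continuous_on {0..} g" and t: "0 \<le> t"
  shows "(\<exists>s\<in>{0..t}. g s \<le> a) \<longleftrightarrow>
    (\<forall>n::nat. \<exists>q::rat. g (max 0 (min (of_rat q) t)) < a + inverse (real (Suc n)))"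
proof
  assume "\<exists>s\<in>{0..t}. g s \<le> a"
  then obtain s where s: "0 \<le> s" "s \<le> t" "g s \<le> a" by auto
  show "\<forall>n::nat. \<exists>q::rat. g (max 0 (min (of_rat q) t)) < a + inverse (real (Suc n))"
  proof
    fix n :: nat
    let ?U = "(\<lambda>r. g (max 0 (min r t))) -` {..< a + inverse (real (Suc n))}"
    have "continuous_on UNIV (\<lambda>r. g (max 0 (min r t)))"
      by (intro continuous_on_compose2[OF g] continuous_intros) auto
    then have "open ?U" by (intro open_vimage open_lessThan)
    moreover have "s \<in> ?U" using s by (auto simp: less_le_trans add_strict_increasing2 le_less_trans)
    ultimately obtain d where "0 < d" "ball s d \<subseteq> ?U" by (meson openE)
    moreover obtain q :: rat where "s < of_rat q" "of_rat q < s + d"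
      using of_rat_dense[of s "s + d"] \<open>0 < d\<close> by auto
    ultimately show "\<exists>q::rat. g (max 0 (min (of_rat q) t)) < a + inverse (real (Suc n))"
      by (intro exI[of _ q]) (auto simp: subset_eq dist_real_def)
  qed
next
  assume approx: "\<forall>n::nat. \<exists>q::rat. g (max 0 (min (of_rat q) t)) < a + inverse (real (Suc n))"
  have "continuous_on {0..t} g" using g by (rule continuous_on_subset) auto
  then obtain s where s: "s \<in> {0..t}" "\<And>r. r \<in> {0..t} \<Longrightarrow> g s \<le> g r"
    using continuous_attains_inf[of "{0..t}" g] t by auto
  have "g s \<le> a + inverse (real (Suc n))" for n
  proof -
    obtain q :: rat where "g (max 0 (min (of_rat q) t)) < a + inverse (real (Suc n))"
      using approx by blast
    moreover have "g s \<le> g (max 0 (min (of_rat q) t))" using t by (intro s(2)) auto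
    ultimately show ?thesis by simp
  qed
  moreover have "(\<lambda>n. a + inverse (real (Suc n))) \<longlonglongrightarrow> a + 0"
    by (rule tendsto_add[OF tendsto_const LIMSEQ_inverse_real_of_nat])
  ultimately have "g s \<le> a" by (auto intro: LIMSEQ_le_const)
  with s(1) show "\<exists>s\<in>{0..t}. g s \<le> a" by blast
qed

section \<open>Measurability of the quadruples\<close>

lemma borel_measurable_hitting_time:
  fixes f :: "'a::topological_space \<Rightarrow> real"
  assumes X: "\<And>t. 0 \<le> t \<Longrightarrow> (\<lambda>\<omega>. X \<omega> t) \<in> borel_measurable M"
    and cont: "\<And>\<omega>. \<omega> \<in> space M \<Longrightarrow> continuous_on {0..} (X \<omega>)"
    and f: "continuous_on UNIV f"
  shows "(\<lambda>\<omega>. hitting_time {y. f y \<le> a} (X \<omega>)) \<in> borel_measurable M"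
proof (rule borel_measurableI_le)
  fix y :: ennreal
  show "{\<omega> \<in> space M. hitting_time {y. f y \<le> a} (X \<omega>) \<le> y} \<in> sets M"
  proof (cases y)
    case (real t)
    have "closed {y. f y \<le> a}" using f by (intro closed_Collect_le) auto
    then have "hitting_time {y. f y \<le> a} (X \<omega>) \<le> y \<longleftrightarrow>
      (\<forall>n::nat. \<exists>q::rat. f (X \<omega> (max 0 (min (of_rat q) t))) < a + inverse (real (Suc n)))"
      if "\<omega> \<in> space M" for \<omega>
      using cont[OF that] real
      by (simp add: hitting_time_le_iff continuous_on_compose2[OF f]
          attains_sublevel_iff_rationals[of "\<lambda>s. f (X \<omega> s)"] del: of_nat_Suc)
    then have eq: "{\<omega> \<in> space M. hitting_time {y. f y \<le> a} (X \<omega>) \<le> y} =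
      {\<omega> \<in> space M. \<forall>n::nat. \<exists>q::rat. f (X \<omega> (max 0 (min (of_rat q) t))) < a + inverse (real (Suc n))}"
      by blast
    have fX [measurable]: "(\<lambda>\<omega>. f (X \<omega> (max 0 s))) \<in> borel_measurable M" for s
      using measurable_compose[OF X borel_measurable_continuous_onI[OF f]] by simp
    show ?thesis unfolding eq by measurable
  qed simp
qed

text \<open>
  Rounding the random time up to the grid of mesh \<open>1 / Suc n\<close> leaves countably many values, for which
  the claim is clear; continuity of the paths allows \<open>n\<close> to tend to infinity.
\<close>

lemma borel_measurable_value_at:
  fixes X :: "'w \<Rightarrow> real \<Rightarrow> 'a::metric_space"
  assumes X: "\<And>t. 0 \<le> t \<Longrightarrow> (\<lambda>\<omega>. X \<omega> t) \<in> borel_measurable M"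
    and cont: "\<And>\<omega>. \<omega> \<in> space M \<Longrightarrow> continuous_on {0..} (X \<omega>)"
    and s [measurable]: "s \<in> borel_measurable M"
  shows "(\<lambda>\<omega>. value_at (X \<omega>) (s \<omega>)) \<in> borel_measurable M"
proof -
  define grid where "grid n \<omega> = real (nat \<lceil>real (Suc n) * enn2real (s \<omega>)\<rceil>) / real (Suc n)" for n \<omega>
  have "(\<lambda>\<omega>. X \<omega> (grid n \<omega>)) \<in> borel_measurable M" for n
  proof -
    have "(\<lambda>\<omega>. nat \<lceil>real (Suc n) * enn2real (s \<omega>)\<rceil>) \<in> M \<rightarrow>\<^sub>M count_space UNIV" by measurable
    with X show ?thesis
      unfolding grid_def
      by (rule measurable_compose_countable[where f = "\<lambda>k \<omega>. X \<omega> (real k / real (Suc n))"]) simp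
  qed
  moreover have "(\<lambda>n. X \<omega> (grid n \<omega>)) \<longlonglongrightarrow> value_at (X \<omega>) (s \<omega>)" if "\<omega> \<in> space M" for \<omega>
  proof -
    let ?r = "enn2real (s \<omega>)"
    have bounds: "?r \<le> grid n \<omega>" "grid n \<omega> \<le> ?r + inverse (real (Suc n))" for n
    proof -
      let ?N = "real (Suc n)" and ?c = "\<lceil>real (Suc n) * ?r\<rceil>"
      have N: "0 < ?N" by simp
      have "0 \<le> ?N * ?r" by simp
      then have "0 \<le> ?c" by (metis ceiling_mono ceiling_zero)
      then have grid: "grid n \<omega> = of_int ?c / ?N" by (simp add: grid_def)
      have "?N * ?r \<le> of_int ?c" by (rule le_of_int_ceiling)
      then show "?r \<le> grid n \<omega>"
        using N unfolding grid by (simp only: pos_le_divide_eq mult.commute)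
      have "of_int ?c \<le> ?N * ?r + 1" by linarith
      also have "\<dots> = ?N * (?r + inverse ?N)"
        by (simp only: distrib_left right_inverse of_nat_neq_0 not_False_eq_True)
      finally show "grid n \<omega> \<le> ?r + inverse ?N"
        using N unfolding grid by (simp only: pos_divide_le_eq mult.commute)
    qed
    have "(\<lambda>n. ?r + inverse (real (Suc n))) \<longlonglongrightarrow> ?r"
      using tendsto_add[OF tendsto_const LIMSEQ_inverse_real_of_nat] by simp
    then have "(\<lambda>n. grid n \<omega>) \<longlonglongrightarrow> ?r"
      by (rule tendsto_sandwich[OF _ _ tendsto_const, rotated -1])
        (rule always_eventually allI bounds)+
    moreover have "\<forall>\<^sub>F n in sequentially. grid n \<omega> \<in> {0..}"
      by (intro always_eventually allI) (simp add: order_trans[OF enn2real_nonneg bounds(1)])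
    ultimately show ?thesis
      unfolding value_at_def
      by (intro continuous_on_tendsto_compose[OF cont[OF that]]) simp_all
  qed
  ultimately show ?thesis by (rule borel_measurable_LIMSEQ_metric)
qed

text \<open>
  A finite delayed time is one of countably many multiples of \<open>T\<close>, so measurability of \<open>Y\<close> at each of
  them suffices. At \<open>s \<omega> = \<infinity>\<close> the dummy value \<open>Y \<omega> 0\<close> appears, to which the index \<open>0\<close> is assigned.
\<close>

lemma borel_measurable_value_at_delay:
  fixes Y :: "'w \<Rightarrow> real \<Rightarrow> 'a::topological_space"
  assumes "0 < T" and Y: "\<And>n. (\<lambda>\<omega>. Y \<omega> (real n * T)) \<in> borel_measurable M"
    and s [measurable]: "s \<in> borel_measurable M"
  shows "(\<lambda>\<omega>. value_at (Y \<omega>) (delay T (s \<omega>))) \<in> borel_measurable M"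
proof -
  define n where "n \<omega> = (if s \<omega> = \<infinity> then 0 else LEAST n. 1 \<le> n \<and> s \<omega> \<le> ennreal (real n * T))" for \<omega>
  have "n \<in> M \<rightarrow>\<^sub>M count_space UNIV" unfolding n_def by measurable
  with Y have "(\<lambda>\<omega>. Y \<omega> (real (n \<omega>) * T)) \<in> borel_measurable M"
    by (rule measurable_compose_countable)
  moreover have "value_at (Y \<omega>) (delay T (s \<omega>)) = Y \<omega> (real (n \<omega>) * T)" for \<omega>
    using \<open>0 < T\<close> by (simp add: value_at_def delay_def n_def mult.commute)
  ultimately show ?thesis by simp
qed

lemma borel_measurable_delay [measurable]:
  "delay T \<in> borel_measurable borel"
  unfolding delay_def by measurable

lemma upper_set_eq_sublevel: "upper_set \<xi> z i = {y. - \<xi> y \<le> - z i}"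
  by (auto simp: upper_set_def)

lemma lower_set_eq_sublevel: "lower_set \<xi> zA = {y. \<xi> y \<le> zA}"
  by (auto simp: lower_set_def)

lemma closed_upper_set: "continuous_on UNIV \<xi> \<Longrightarrow> closed (upper_set \<xi> z i)"
  unfolding upper_set_eq_sublevel by (intro closed_Collect_le continuous_intros)

lemma closed_lower_set: "continuous_on UNIV \<xi> \<Longrightarrow> closed (lower_set \<xi> zA)"
  unfolding lower_set_eq_sublevel by (intro closed_Collect_le continuous_intros)


text \<open>
  The paths of \<open>X\<close> may be discontinuous on a null set, which is measurable by completeness;
  there they are replaced by a constant path.
\<close>

lemma (in complete_measure) continuous_process_modification:
  fixes X :: "'a \<Rightarrow> real \<Rightarrow> 'b::topological_space"
  assumes "continuous_process M X"
  shows "\<exists>X'. (\<forall>t\<ge>0. (\<lambda>\<omega>. X' \<omega> t) \<in> borel_measurable M) \<and>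
    (\<forall>\<omega>\<in>space M. continuous_on {0..} (X' \<omega>)) \<and> (AE \<omega> in M. X' \<omega> = X \<omega>)"
proof (intro exI conjI allI ballI impI)
  define bad where "bad = {\<omega> \<in> space M. \<not> continuous_on {0..} (X \<omega>)}"
  define X' where "X' \<omega> = (if \<omega> \<in> bad then (\<lambda>_. undefined) else X \<omega>)" for \<omega>
  have X: "(\<lambda>\<omega>. X \<omega> t) \<in> borel_measurable M" if "0 \<le> t" for t
    using assms that by (simp add: continuous_process_def)
  have null: "bad \<in> null_sets M"
    unfolding bad_def AE_iff_null_sets[symmetric] using assms by (simp add: continuous_process_def)
  show "(\<lambda>\<omega>. X' \<omega> t) \<in> borel_measurable M" if "0 \<le> t" for t
  proof -
    have "(\<lambda>\<omega>. if \<omega> \<in> bad then undefined else X \<omega> t) \<in> borel_measurable M"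
      using null X[OF that] by (intro measurable_If_set) auto
    also have "(\<lambda>\<omega>. if \<omega> \<in> bad then undefined else X \<omega> t) = (\<lambda>\<omega>. X' \<omega> t)"
      by (auto simp: X'_def)
    finally show ?thesis .
  qed
  show "continuous_on {0..} (X' \<omega>)" if "\<omega> \<in> space M" for \<omega>
    using that by (auto simp: X'_def bad_def)
  show "AE \<omega> in M. X' \<omega> = X \<omega>"
    using AE_not_in[OF null] by eventually_elim (simp add: X'_def)
qed

lemma (in complete_measure) measurable_AE_eq:
  assumes f: "f \<in> M \<rightarrow>\<^sub>M L" and eq: "AE \<omega> in M. f \<omega> = g \<omega>" and g: "\<And>\<omega>. g \<omega> \<in> space L"
  shows "g \<in> M \<rightarrow>\<^sub>M L"
proof (rule measurableI)
  fix A assume A: "A \<in> sets L"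
  show "g -` A \<inter> space M \<in> sets M"
  proof (rule in_sets_AE)
    show "AE \<omega> in M. \<omega> \<in> f -` A \<inter> space M \<longleftrightarrow> \<omega> \<in> g -` A \<inter> space M"
      using eq by eventually_elim simp
  qed (use f A in auto)
qed (rule g)

lemma (in complete_measure) borel_measurable_level_times:
  fixes X :: "'a \<Rightarrow> real \<Rightarrow> 'b::topological_space"
  assumes X: "continuous_process M X" and \<xi>: "continuous_on UNIV \<xi>"
  shows "(\<lambda>\<omega>. hitting_time (upper_set \<xi> z i) (X \<omega>)) \<in> borel_measurable M"
    and "(\<lambda>\<omega>. hitting_time (lower_set \<xi> zA) (X \<omega>)) \<in> borel_measurable M"
proof -
  obtain X' where X': "\<And>t. 0 \<le> t \<Longrightarrow> (\<lambda>\<omega>. X' \<omega> t) \<in> borel_measurable M"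
    "\<And>\<omega>. \<omega> \<in> space M \<Longrightarrow> continuous_on {0..} (X' \<omega>)" and eq: "AE \<omega> in M. X' \<omega> = X \<omega>"
    using continuous_process_modification[OF X] by blast
  have "(\<lambda>\<omega>. hitting_time {y. f y \<le> a} (X \<omega>)) \<in> borel_measurable M"
    if "continuous_on UNIV f" for f :: "'b \<Rightarrow> real" and a
  proof (rule measurable_AE_eq)
    show "(\<lambda>\<omega>. hitting_time {y. f y \<le> a} (X' \<omega>)) \<in> borel_measurable M"
      using X' that by (rule borel_measurable_hitting_time)
    show "AE \<omega> in M. hitting_time {y. f y \<le> a} (X' \<omega>) = hitting_time {y. f y \<le> a} (X \<omega>)"
      using eq by eventually_elim simp
  qed simp
  from this[OF \<xi>] this[OF continuous_on_minus[OF \<xi>]]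
  show "(\<lambda>\<omega>. hitting_time (upper_set \<xi> z i) (X \<omega>)) \<in> borel_measurable M"
    and "(\<lambda>\<omega>. hitting_time (lower_set \<xi> zA) (X \<omega>)) \<in> borel_measurable M"
    by (simp_all only: upper_set_eq_sublevel lower_set_eq_sublevel)
qed

lemma (in complete_measure) borel_measurable_quadruple:
  fixes X :: "'a \<Rightarrow> real \<Rightarrow> 'b::{metric_space, second_countable_topology}"
  assumes X: "continuous_process M X" and \<xi>: "continuous_on UNIV \<xi>" and T: "0 < T"
    and Y: "\<And>n. (\<lambda>\<omega>. Y \<omega> (real n * T)) \<in> borel_measurable M"
  shows "(\<lambda>\<omega>. quadruple \<xi> zA z T i (X \<omega>) (Y \<omega>)) \<in> borel_measurable M"
proof -
  have [measurable]: "(\<lambda>\<omega>. X \<omega> 0) \<in> borel_measurable M"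
    using X by (simp add: continuous_process_def)
  have s [measurable]: "(\<lambda>\<omega>. exit_time \<xi> zA z i (X \<omega>)) \<in> borel_measurable M"
    unfolding exit_time_def
    by (intro borel_measurable_min borel_measurable_level_times X \<xi>)
  obtain X' where X': "\<And>t. 0 \<le> t \<Longrightarrow> (\<lambda>\<omega>. X' \<omega> t) \<in> borel_measurable M"
    "\<And>\<omega>. \<omega> \<in> space M \<Longrightarrow> continuous_on {0..} (X' \<omega>)" and eq: "AE \<omega> in M. X' \<omega> = X \<omega>"
    using continuous_process_modification[OF X] by blast
  have [measurable]: "(\<lambda>\<omega>. value_at (X \<omega>) (exit_time \<xi> zA z i (X \<omega>))) \<in> borel_measurable M"
  proof (rule measurable_AE_eq)
    show "(\<lambda>\<omega>. value_at (X' \<omega>) (exit_time \<xi> zA z i (X \<omega>))) \<in> borel_measurable M"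
      using X' s by (rule borel_measurable_value_at)
    show "AE \<omega> in M. value_at (X' \<omega>) (exit_time \<xi> zA z i (X \<omega>)) =
        value_at (X \<omega>) (exit_time \<xi> zA z i (X \<omega>))"
      using eq by eventually_elim simp
  qed simp
  have [measurable]: "(\<lambda>\<omega>. value_at (Y \<omega>) (delay T (exit_time \<xi> zA z i (X \<omega>)))) \<in> borel_measurable M"
    using T Y s by (rule borel_measurable_value_at_delay)
  show ?thesis
    unfolding quadruple_def Let_def by (cases "i = 0") simp_all
qed

section \<open>Potentials and the order of hitting times\<close>

text \<open>
  Both sets are closed, so a continuous path lies in the set at the time at which it hits it, and
  the sets are disjoint, so it cannot hit both at the same time. If neither set is ever hit, the
  potential is evaluated at the dummy value \<open>x 0\<close>; this lies outside the upper set, since otherwise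
  the upper set would have been hit at time \<open>0\<close>.
\<close>

lemma potential_quadruple_eq_1_iff:
  assumes x: "continuous_on {0..} x" and \<xi>: "continuous_on UNIV \<xi>" and i: "1 \<le> i" and z: "zA < z i"
  shows "potential \<xi> z i (quadruple \<xi> zA z T i x y) = 1 \<longleftrightarrow>
    hitting_time (upper_set \<xi> z i) x < hitting_time (lower_set \<xi> zA) x"
    (is "_ \<longleftrightarrow> ?tB < ?tA")
proof -
  let ?s = "exit_time \<xi> zA z i x"
  have s: "?s = min ?tA ?tB" by (simp add: exit_time_def)
  have "value_at x ?s \<in> upper_set \<xi> z i \<longleftrightarrow> ?tB < ?tA"
  proof
    assume "?tB < ?tA"
    then have "?s = ?tB" "?tB < \<infinity>" by (auto simp: s intro: less_le_trans)
    then show "value_at x ?s \<in> upper_set \<xi> z i"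
      using hitting_time_attained[OF x closed_upper_set[OF \<xi>]]
      by (metis enn2real_ennreal value_at_def)
  next
    assume hit: "value_at x ?s \<in> upper_set \<xi> z i"
    then have "?tB \<le> ennreal (enn2real ?s)"
      unfolding value_at_def by (intro hitting_time_le) auto
    moreover have "ennreal (enn2real ?s) \<le> ?s" by (cases ?s) simp_all
    ultimately have eq: "?tB = ?s" "?s = ennreal (enn2real ?s)"
      by (auto simp: s intro: antisym order_trans)
    show "?tB < ?tA"
    proof (rule ccontr)
      assume "\<not> ?tB < ?tA"
      with eq have "?tA = ?s" by (auto simp: s)
      with eq obtain t where "0 \<le> t" "?s = ennreal t" "x t \<in> lower_set \<xi> zA"
        using hitting_time_attained[OF x closed_lower_set[OF \<xi>], of zA] by (metis ennreal_less_top infinity_ennreal_def)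
      with hit z show False by (auto simp: value_at_def upper_set_def lower_set_def)
    qed
  qed
  then show ?thesis using i by (auto simp: potential_def quadruple_def Let_def)
qed

section \<open>Names of particles\<close>

context splitting_run
begin

primrec particle_names :: "nat \<Rightarrow> nat list set" where
  "particle_names 0 = {[]}"
| "particle_names (Suc i) = (\<lambda>(u, k). u @ [k]) ` (particle_names i \<times> {..<copies i})"

lemma finite_particle_names: "finite (particle_names i)"
  by (induction i) auto

lemma card_particle_names: "card (particle_names i) = (\<Prod>h<i. copies h)"
proof (induction i)
  case (Suc i)
  have "card (particle_names (Suc i)) = card (particle_names i \<times> {..<copies i})"
    by (auto intro!: card_image inj_onI)
  with Suc show ?case by (simp add: card_cartesian_product)
qed simp

lemma Nil_notin_survivors_Suc: "[] \<notin> set (survivors (Suc i) \<omega>)"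
  by (auto simp: offspring_def)

lemma snoc_in_survivors_Suc_iff:
  "u @ [k] \<in> set (survivors (Suc i) \<omega>) \<longleftrightarrow>
    u \<in> set (survivors i \<omega>) \<and> k < copies i \<and> potential \<xi> z (Suc i) (V (Suc i) (u @ [k]) \<omega>) = 1"
  by (auto simp: offspring_def image_iff)

lemma survivors_subset: "set (survivors i \<omega>) \<subseteq> particle_names i"
proof (induction i)
  case (Suc i)
  then show ?case by (force simp: offspring_def)
qed simp

lemma distinct_offspring: "distinct us \<Longrightarrow> distinct (offspring i us)"
proof (induction us)
  case (Cons u us)
  then show ?case by (auto simp: offspring_def distinct_map intro!: inj_onI)
qed (simp add: offspring_def)

text \<open>
  The survivors form a random list; summing indicators over the deterministic set of all names makes
  linearity of expectation applicable.
\<close>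

lemma survivor_count_eq_sum:
  "real (survivor_count i \<omega>) = (\<Sum>u\<in>particle_names i. indicator {\<omega>. u \<in> set (survivors i \<omega>)} \<omega>)"
proof -
  have "distinct (survivors i \<omega>)"
    by (induction i) (simp_all add: distinct_offspring)
  then have "survivor_count i \<omega> = card (set (survivors i \<omega>))"
    by (simp add: survivor_count_def distinct_card)
  also have "set (survivors i \<omega>) = {u \<in> particle_names i. u \<in> set (survivors i \<omega>)}"
    using survivors_subset by blast
  finally show ?thesis
    by (simp add: indicator_def finite_particle_names sum.If_cases Int_def)
qed

lemma survivors_extinct: "survivors i \<omega> = [] \<Longrightarrow> i \<le> h \<Longrightarrow> survivors h \<omega> = []"
  by (induction h) (auto simp: le_Suc_eq offspring_def)

text \<open>
  The early return of \<open>0\<close> agrees with the general formula, as an extinct population has no survivors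
  at the last stage either.
\<close>

lemma estimator_eq:
  assumes "1 \<le> m"
  shows "estimator \<omega> = real (survivor_count m \<omega>) / real (card (particle_names m))"
proof -
  have "(\<Prod>h<m. copies h) = N0 * (\<Prod>i\<in>{1..m - 1}. R i)"
  proof -
    have "{..<m} = insert 0 {1..m - 1}" using assms by auto
    then show ?thesis by (simp add: copies_def)
  qed
  moreover have "survivor_count m \<omega> = 0" if "\<exists>i\<in>{2..m}. survivor_count (i - 1) \<omega> = 0"
  proof -
    from that obtain i where "i \<le> m" "survivors (i - 1) \<omega> = []"
      by (auto simp: survivor_count_def)
    with survivors_extinct[of "i - 1" \<omega> m] show ?thesis by (simp add: survivor_count_def)
  qed
  ultimately show ?thesis by (auto simp: estimator_def card_particle_names)
qed

end

section \<open>The law of one ancestral line\<close>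

text \<open>
  The hypothesis \<open>law\<close> says that \<open>V\<close> on \<open>A\<close> and \<open>U\<close> on \<open>B\<close> have the same unnormalised distribution. It is
  what carries the integral of a kernel over from the particle system to the reference process.
\<close>

lemma integral_comp_eq_of_same_law:
  fixes f :: "'c \<Rightarrow> real"
  assumes "finite_measure M" "finite_measure N"
    and [measurable]: "A \<in> sets M" "B \<in> sets N" "V \<in> M \<rightarrow>\<^sub>M L" "U \<in> N \<rightarrow>\<^sub>M L" "f \<in> borel_measurable L"
    and law: "\<And>C. C \<in> sets L \<Longrightarrow>
      measure M {\<omega> \<in> A. V \<omega> \<in> C} = measure N {\<omega> \<in> B. U \<omega> \<in> C}"
  shows "(LINT \<omega>:A|M. f (V \<omega>)) = (LINT \<omega>:B|N. f (U \<omega>))"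
proof -
  interpret M: finite_measure M by fact
  interpret N: finite_measure N by fact
  have AM: "A \<inter> space M \<in> sets M" and BN: "B \<inter> space N \<in> sets N" by auto
  have V: "V \<in> restrict_space M A \<rightarrow>\<^sub>M L" and U: "U \<in> restrict_space N B \<rightarrow>\<^sub>M L"
    by (auto intro: measurable_restrict_space1)
  have "distr (restrict_space M A) L V = distr (restrict_space N B) L U"
  proof (rule measure_eqI)
    fix C assume "C \<in> sets (distr (restrict_space M A) L V)"
    then have [measurable]: "C \<in> sets L" by simp
    have "V -` C \<inter> space (restrict_space M A) = {\<omega> \<in> A. V \<omega> \<in> C}"
      "U -` C \<inter> space (restrict_space N B) = {\<omega> \<in> B. U \<omega> \<in> C}"
      using sets.sets_into_space[OF \<open>A \<in> sets M\<close>] sets.sets_into_space[OF \<open>B \<in> sets N\<close>]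
      by (auto simp: space_restrict_space)
    then show "emeasure (distr (restrict_space M A) L V) C = emeasure (distr (restrict_space N B) L U) C"
      using law[OF \<open>C \<in> sets L\<close>]
      by (simp add: emeasure_distr[OF V] emeasure_distr[OF U] emeasure_restrict_space
          M.emeasure_eq_measure N.emeasure_eq_measure subset_eq)
  qed simp
  then have "(\<integral>\<omega>. f (V \<omega>) \<partial>restrict_space M A) = (\<integral>\<omega>. f (U \<omega>) \<partial>restrict_space N B)"
    using integral_distr[OF V, of f] integral_distr[OF U, of f] by simp
  then show ?thesis
    by (simp add: integral_restrict_space set_lebesgue_integral_def)
qed

lemma sets_potential_eq_1:
  fixes \<xi> :: "'a::{second_countable_topology, topological_space} \<Rightarrow> real"
  assumes "continuous_on UNIV \<xi>"
  shows "{v. potential \<xi> z i v = 1} \<in> sets borel"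
proof -
  have "{v. potential \<xi> z i v = 1} = {v. z i \<le> \<xi> (fst (snd (snd v)))}"
    by (auto simp: potential_def upper_set_def split: if_splits)
  also have "closed \<dots>"
    by (intro closed_Collect_le continuous_intros continuous_on_compose2[OF assms]) auto
  finally show ?thesis by (rule borel_closed)
qed

lemma distr_path_law_initial:
  assumes "continuous_process M X"
  shows "distr (path_law M X) borel (\<lambda>x. x 0) = distr M borel (\<lambda>\<omega>. X \<omega> 0)"
proof -
  have "(\<lambda>\<omega>. restrict (X \<omega>) {0..}) \<in> M \<rightarrow>\<^sub>M path_algebra"
    using assms unfolding path_algebra_def continuous_process_def by (intro measurable_restrict) auto
  moreover have "(\<lambda>x. x 0) \<in> path_algebra \<rightarrow>\<^sub>M borel"
    unfolding path_algebra_def by (rule measurable_component_singleton) simp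
  ultimately show ?thesis by (subst path_law_def, subst distr_distr) (simp_all add: comp_def)
qed

text \<open>
  The right-hand side depends on the process through its path law only, so equality of the path
  laws of a first-stage particle and of \<open>X\<close> yields equality of the laws of their initial quadruples.
\<close>

lemma measure_quadruple_0:
  assumes X: "continuous_process M X" and C: "C \<in> sets borel"
  shows "measure M {\<omega> \<in> space M. quadruple \<xi> zA z T 0 (X \<omega>) (Y \<omega>) \<in> C} =
    measure (distr (path_law M X) borel (\<lambda>x. x 0)) {x. (0, 0, x, x) \<in> C}"
proof -
  have "(\<lambda>\<omega>. X \<omega> 0) \<in> borel_measurable M"
    using X by (simp add: continuous_process_def)
  moreover have "(\<lambda>x. (0, 0, x, x)) -` C \<in> sets borel"
  proof -
    have "(\<lambda>x. (0, 0, x, x)) \<in> borel_measurable borel"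
      by (intro borel_measurable_continuous_onI continuous_intros)
    from measurable_sets[OF this C] show ?thesis by simp
  qed
  ultimately show ?thesis
    by (simp add: distr_path_law_initial[OF X] measure_distr quadruple_def vimage_def Int_def conj_commute)
qed

context coupled_splitting
begin

lemma borel_measurable_V:
  assumes \<xi>: "continuous_on UNIV \<xi>" and T: "0 < T" and eps: "0 < eps"
  shows "V i u \<in> borel_measurable N"
proof -
  have "(\<lambda>\<omega>. Zt u eps \<omega> (real n * T)) \<in> borel_measurable N" for n
    using eps_strong[of n u] eps T unfolding eps_strong_sampler_def by (auto simp: mult_right_mono)
  then show ?thesis
    unfolding V_def [abs_def] by (intro borel_measurable_quadruple continuous_paths \<xi> T)
qed

lemma sets_mem_survivors:
  assumes \<xi>: "continuous_on UNIV \<xi>" and T: "0 < T" and eps: "0 < eps"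
  shows "{\<omega> \<in> space N. u \<in> set (survivors i \<omega>)} \<in> sets N"
proof (induction i arbitrary: u)
  case 0
  show ?case by simp
next
  case (Suc i)
  show ?case
  proof (cases u rule: rev_cases)
    case Nil
    have none: "{\<omega> \<in> space N. u \<in> set (survivors (Suc i) \<omega>)} = {}"
      using Nil_notin_survivors_Suc Nil by auto
    show ?thesis unfolding none by simp
  next
    case (snoc w k)
    have "{\<omega> \<in> space N. u \<in> set (survivors (Suc i) \<omega>)} =
      (if k < copies i then {\<omega> \<in> space N. w \<in> set (survivors i \<omega>)} \<inter>
        (V (Suc i) u -` {v. potential \<xi> z (Suc i) v = 1} \<inter> space N) else {})"
      unfolding snoc snoc_in_survivors_Suc_iff by auto
    then show ?thesis
      using Suc.IH[of w] measurable_sets[OF borel_measurable_V sets_potential_eq_1] assms by auto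
  qed
qed

text \<open>
  The reference process \<open>U\<close> is Markov with the kernels \<open>K i\<close>, and a particle draws its next quadruple
  from the same kernel given the quadruple of its surviving parent. Selection at stage \<open>i\<close> intersects
  the event with that of potential \<open>1\<close> on both sides. The first stage is separate because the particles
  of that stage start from the initial law and not from a selected parent.
\<close>

lemma survivor_law:
  fixes M :: "'w measure" and U :: "nat \<Rightarrow> 'w \<Rightarrow> (real ^ 'd) quadruple"
  assumes \<xi>: "continuous_on UNIV \<xi>" and T: "0 < T" and eps: "0 < eps"
    and M: "prob_space M"
    and kernel: "\<And>i. i \<in> {1..m} \<Longrightarrow> transition_kernel M U i (K i)"
    and start: "\<And>j C. j < N0 \<Longrightarrow> C \<in> sets borel \<Longrightarrow>
      measure N {\<omega> \<in> space N. V 0 [j] \<omega> \<in> C} = measure M {\<omega> \<in> space M. U 0 \<omega> \<in> C}"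
    and i: "1 \<le> i" "i \<le> m" and u: "u \<in> particle_names i" and D: "D \<in> sets borel"
  shows "measure N {\<omega> \<in> space N. u \<in> set (survivors i \<omega>) \<and> V i u \<omega> \<in> D} =
    measure M {\<omega> \<in> space M. (\<forall>h\<in>{1..i}. potential \<xi> z h (U h \<omega>) = 1) \<and> U i \<omega> \<in> D}"
proof -
  note V = borel_measurable_V[OF \<xi> T eps]
  interpret M: prob_space M by fact
  define G where "G h = {v. potential \<xi> z h v = 1}" for h
  have G: "G h \<in> sets borel" for h
    unfolding G_def by (rule sets_potential_eq_1[OF \<xi>])
  define past where "past i = {\<omega> \<in> space M. \<forall>h\<in>{1..i}. potential \<xi> z h (U h \<omega>) = 1}" for i
  have U: "U h \<in> borel_measurable M" if "h \<le> m" "1 \<le> m" for h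
    using kernel[of m] that by (auto simp: transition_kernel_def)
  have past: "past i \<in> sets M" if "i \<le> m" "1 \<le> m" for i
  proof -
    have "{\<omega> \<in> space M. potential \<xi> z h (U h \<omega>) = 1} \<in> sets M" if "h \<in> {1..i}" for h
    proof -
      have "h \<le> m" using that \<open>i \<le> m\<close> by simp
      from measurable_sets[OF U[OF this \<open>1 \<le> m\<close>] G[of h]] show ?thesis
        by (simp add: G_def vimage_def Int_def conj_commute)
    qed
    then show ?thesis unfolding past_def by (intro sets.sets_Collect_finite_All finite_atLeastAtMost)
  qed
  have K: "(\<lambda>v. measure (K i v) D) \<in> borel_measurable borel" if "i \<in> {1..m}" "D \<in> sets borel" for i D
    using kernel[OF that(1)] that(2) unfolding transition_kernel_def
    by (auto intro!: measurable_compose[OF measurable_prob_algebraD measurable_measure_subprob_algebra])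
  have step: "(LINT \<omega>:past i|M. measure (K (Suc i) (U i \<omega>)) (G (Suc i) \<inter> D)) =
      measure M {\<omega> \<in> space M. (\<forall>h\<in>{1..Suc i}. potential \<xi> z h (U h \<omega>) = 1) \<and> U (Suc i) \<omega> \<in> D}"
    if "Suc i \<le> m" and D: "D \<in> sets borel" for i D
  proof -
    \<comment> \<open>no selection takes place at stage 0\<close>
    define C where "C h = (if h = 0 then UNIV else G h)" for h
    have one_step: "\<forall>C D. (\<forall>h<Suc i. C h \<in> sets borel) \<and> D \<in> sets borel \<longrightarrow>
      measure M {\<omega> \<in> space M. (\<forall>h<Suc i. U h \<omega> \<in> C h) \<and> U (Suc i) \<omega> \<in> D} =
      (LINT \<omega>:{\<omega> \<in> space M. \<forall>h<Suc i. U h \<omega> \<in> C h}|M. measure (K (Suc i) (U i \<omega>)) D)"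
      using kernel[of "Suc i"] that(1) by (simp add: transition_kernel_def)
    have "(\<forall>h<Suc i. C h \<in> sets borel) \<and> G (Suc i) \<inter> D \<in> sets borel"
      using G D by (auto simp: C_def)
    then have "measure M {\<omega> \<in> space M. (\<forall>h<Suc i. U h \<omega> \<in> C h) \<and> U (Suc i) \<omega> \<in> G (Suc i) \<inter> D} =
      (LINT \<omega>:{\<omega> \<in> space M. \<forall>h<Suc i. U h \<omega> \<in> C h}|M. measure (K (Suc i) (U i \<omega>)) (G (Suc i) \<inter> D))"
      by (rule one_step[THEN spec, THEN spec, THEN mp])
    moreover have "{\<omega> \<in> space M. \<forall>h<Suc i. U h \<omega> \<in> C h} = past i"
      by (auto simp: past_def C_def G_def less_Suc_eq_le)
    moreover have "{\<omega> \<in> space M. (\<forall>h<Suc i. U h \<omega> \<in> C h) \<and> U (Suc i) \<omega> \<in> G (Suc i) \<inter> D} =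
      {\<omega> \<in> space M. (\<forall>h\<in>{1..Suc i}. potential \<xi> z h (U h \<omega>) = 1) \<and> U (Suc i) \<omega> \<in> D}"
      by (auto simp: C_def G_def less_Suc_eq_le atLeastAtMostSuc_conv)
    ultimately show ?thesis by simp
  qed
  show ?thesis using i u D
  proof (induction i arbitrary: u D rule: nat_induct_at_least)
    case base
    then obtain j where j: "u = [j]" "j < N0" by (auto simp: copies_def)
    let ?C = "{\<omega> \<in> space N. V 0 [j] \<omega> \<in> UNIV}"
    have "{\<omega> \<in> space N. u \<in> set (survivors 1 \<omega>) \<and> V 1 u \<omega> \<in> D} =
      {\<omega> \<in> space N. V 0 [j] \<omega> \<in> UNIV \<and> V 1 [j] \<omega> \<in> G 1 \<inter> D}"
      using j by (auto simp: G_def offspring_def copies_def)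
    then have "measure N {\<omega> \<in> space N. u \<in> set (survivors 1 \<omega>) \<and> V 1 u \<omega> \<in> D} =
      (LINT \<omega>:?C|N. measure (K 1 (V 0 [j] \<omega>)) (G 1 \<inter> D))"
      using stage_one[of j UNIV "G 1 \<inter> D"] j G base by simp
    also have "\<dots> = (LINT \<omega>:past 0|M. measure (K 1 (U 0 \<omega>)) (G 1 \<inter> D))"
    proof (rule integral_comp_eq_of_same_law[where L = borel and V = "V 0 [j]" and U = "U 0"
          and f = "\<lambda>v. measure (K 1 v) (G 1 \<inter> D)"])
      show "measure N {\<omega> \<in> ?C. V 0 [j] \<omega> \<in> C} = measure M {\<omega> \<in> past 0. U 0 \<omega> \<in> C}"
        if "C \<in> sets borel" for C
        using start[OF j(2) that] by (simp add: past_def)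
    qed (use base G in \<open>auto intro!: V U past K finite_measure_axioms M.finite_measure_axioms\<close>)
    finally show ?case using step[of 0 D] base by simp
  next
    case (Suc i)
    then obtain w k where u: "u = w @ [k]" "w \<in> particle_names i" "k < R i"
      by (auto simp: copies_def)
    let ?A = "{\<omega> \<in> space N. w \<in> set (survivors i \<omega>) \<and> V i w \<omega> \<in> UNIV}"
    have "{\<omega> \<in> space N. u \<in> set (survivors (Suc i) \<omega>) \<and> V (Suc i) u \<omega> \<in> D} =
      {\<omega> \<in> space N. w \<in> set (survivors i \<omega>) \<and> V i w \<omega> \<in> UNIV \<and> V (Suc i) (w @ [k]) \<omega> \<in> G (Suc i) \<inter> D}"
      using u Suc.hyps unfolding u(1) snoc_in_survivors_Suc_iff by (auto simp: G_def copies_def)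
    then have "measure N {\<omega> \<in> space N. u \<in> set (survivors (Suc i) \<omega>) \<and> V (Suc i) u \<omega> \<in> D} =
      (LINT \<omega>:?A|N. measure (K (Suc i) (V i w \<omega>)) (G (Suc i) \<inter> D))"
      using later_stages[of "Suc i" k UNIV "G (Suc i) \<inter> D" w] u G Suc.hyps Suc.prems by simp
    also have "\<dots> = (LINT \<omega>:past i|M. measure (K (Suc i) (U i \<omega>)) (G (Suc i) \<inter> D))"
    proof (rule integral_comp_eq_of_same_law[where L = borel and V = "V i w" and U = "U i"
          and f = "\<lambda>v. measure (K (Suc i) v) (G (Suc i) \<inter> D)"])
      show "?A \<in> sets N" using sets_mem_survivors[OF \<xi> T eps] by simp
      show "measure N {\<omega> \<in> ?A. V i w \<omega> \<in> C} = measure M {\<omega> \<in> past i. U i \<omega> \<in> C}" if "C \<in> sets borel" for C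
        using Suc.IH[OF _ u(2) that] Suc.prems by (simp add: past_def conj_assoc)
    qed (use Suc.prems Suc.hyps G in \<open>auto intro!: V U past K finite_measure_axioms M.finite_measure_axioms\<close>)
    finally show ?case using step[of i D] Suc.prems by simp
  qed
qed

section \<open>Unbiasedness\<close>

lemma expectation_estimator:
  assumes \<xi>: "continuous_on UNIV \<xi>" and T: "0 < T" and eps: "0 < eps"
    and M: "prob_space M" and m: "1 \<le> m" and N0: "1 \<le> N0" and R: "\<And>i. i \<in> {1..m - 1} \<Longrightarrow> 0 < R i"
    and kernel: "\<And>i. i \<in> {1..m} \<Longrightarrow> transition_kernel M U i (K i)"
    and start: "\<And>j C. j < N0 \<Longrightarrow> C \<in> sets borel \<Longrightarrow>
      measure N {\<omega> \<in> space N. V 0 [j] \<omega> \<in> C} = measure M {\<omega> \<in> space M. U 0 \<omega> \<in> C}"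
  shows "integrable N estimator"
    and "expectation estimator =
      measure M {\<omega> \<in> space M. \<forall>h\<in>{1..m}. potential \<xi> z h (U h \<omega>) = 1}" (is "_ = ?p")
proof -
  let ?S = "\<lambda>u. {\<omega> \<in> space N. u \<in> set (survivors m \<omega>)}"
  have S: "?S u \<in> sets N" for u by (rule sets_mem_survivors[OF \<xi> T eps])
  have eq: "estimator \<omega> = (\<Sum>u\<in>particle_names m. indicator (?S u) \<omega>) / real (card (particle_names m))"
    if "\<omega> \<in> space N" for \<omega>
    using that by (simp add: estimator_eq[OF m] survivor_count_eq_sum indicator_def)
  have int: "integrable N (indicator (?S u) :: _ \<Rightarrow> real)" for u
    using S by (simp add: emeasure_eq_measure)
  then have "integrable N (\<lambda>\<omega>. (\<Sum>u\<in>particle_names m. indicator (?S u) \<omega>) / real (card (particle_names m)))"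
    by (intro integrable_divide Bochner_Integration.integrable_sum)
  then show "integrable N estimator"
    by (subst Bochner_Integration.integrable_cong[OF refl eq])
  have "expectation estimator =
      expectation (\<lambda>\<omega>. (\<Sum>u\<in>particle_names m. indicator (?S u) \<omega>) / real (card (particle_names m)))"
    by (rule Bochner_Integration.integral_cong[OF refl eq])
  also have "\<dots> = (\<Sum>u\<in>particle_names m. prob (?S u)) / real (card (particle_names m))"
    using int S by (simp add: Bochner_Integration.integral_sum)
  also have "(\<Sum>u\<in>particle_names m. prob (?S u)) = (\<Sum>u\<in>particle_names m. ?p)"
  proof (rule sum.cong[OF refl])
    fix u assume "u \<in> particle_names m"
    have "prob {\<omega> \<in> space N. u \<in> set (survivors m \<omega>) \<and> V m u \<omega> \<in> UNIV} =
      measure M {\<omega> \<in> space M. (\<forall>h\<in>{1..m}. potential \<xi> z h (U h \<omega>) = 1) \<and> U m \<omega> \<in> UNIV}"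
      using \<open>u \<in> particle_names m\<close>
      by (intro survivor_law[where U = U] \<xi> T eps M m order_refl kernel start) auto
    then show "prob (?S u) = ?p" by simp
  qed
  also have "card (particle_names m) \<noteq> 0"
    unfolding card_particle_names using N0 R by (auto simp: copies_def)
  then have "(\<Sum>u\<in>particle_names m. ?p) / real (card (particle_names m)) = ?p" by simp
  finally show "expectation estimator = ?p" .
qed

end

lemma level_mono:
  fixes z :: "nat \<Rightarrow> real"
  assumes "\<And>i. i \<in> {1..<m} \<Longrightarrow> z i < z (Suc i)" and "1 \<le> i" "i \<le> h" "h \<le> m"
  shows "z i \<le> z h"
  using assms(3,2,4)
proof (induction h rule: dec_induct)
  case (step n)
  with assms(1)[of n] show ?case by simp
qed simp

lemma hitting_time_mono: "S \<subseteq> S' \<Longrightarrow> hitting_time S' x \<le> hitting_time S x"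
  unfolding hitting_time_def by (intro INF_superset_mono) auto

theorem proposition1:
  fixes M :: "'w measure" and N :: "'v measure"
    and \<mu> :: "real ^ 'd \<Rightarrow> real ^ 'd" and \<sigma> :: "real ^ 'd \<Rightarrow> real ^ 'e ^ 'd"
    and W :: "'w \<Rightarrow> real \<Rightarrow> real ^ 'e"
    and X :: "'w \<Rightarrow> real \<Rightarrow> real ^ 'd" and Y :: "real ^ 'd \<Rightarrow> 'w \<Rightarrow> real \<Rightarrow> real ^ 'd"
    and Xt :: "real \<Rightarrow> 'w \<Rightarrow> real \<Rightarrow> real ^ 'd"
    and \<nu> :: "(real ^ 'd) measure" and \<xi> :: "real ^ 'd \<Rightarrow> real"
    and zA zB T eps :: real and z :: "nat \<Rightarrow> real" and m N0 :: nat and R :: "nat \<Rightarrow> nat"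
    and nrm :: "real ^ 'd \<Rightarrow> real"
    and K :: "nat \<Rightarrow> (real ^ 'd) quadruple \<Rightarrow> (real ^ 'd) quadruple measure"
    and Z :: "nat list \<Rightarrow> 'v \<Rightarrow> real \<Rightarrow> real ^ 'd"
    and Zt :: "nat list \<Rightarrow> real \<Rightarrow> 'v \<Rightarrow> real \<Rightarrow> real ^ 'd"
  assumes "prob_space M" and "complete_measure M"
    and "\<mu> \<in> borel_measurable borel" and "\<sigma> \<in> borel_measurable borel"
    and "\<exists>c>0. \<forall>x. c \<le> norm (\<sigma> x)"
    and "strong_solution M W \<mu> \<sigma> X"
    and "distr M borel (\<lambda>\<omega>. X \<omega> 0) = \<nu>"
    and "\<And>x. strong_solution M W \<mu> \<sigma> (Y x)" and "\<And>x. AE \<omega> in M. Y x \<omega> 0 = x"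
    and "markov_process M (noise_filtration M (\<lambda>\<omega>. X \<omega> 0) W) (\<lambda>x. path_law M (Y x)) X"
    and "continuous_on UNIV \<xi>"
    and "1 \<le> m" and "zA < z 1" and "\<And>i. i \<in> {1..<m} \<Longrightarrow> z i < z (Suc i)" and "z m = zB"
    and "positive_recurrent M Y (lower_set \<xi> zA)"
    and "support \<nu> \<subseteq> \<xi> -` {zA..zB}"
    and "0 < T" and "0 < eps" and "is_norm nrm"
    and "\<And>n. eps_strong_sampler M nrm (real n * T) (real (Suc n) * T) X Xt"
    and "\<And>i. i \<in> {1..m} \<Longrightarrow>
           transition_kernel M (\<lambda>h \<omega>. quadruple \<xi> zA z T h (X \<omega>) (Xt eps \<omega>)) i (K i)"
    and "1 \<le> N0" and "\<And>i. i \<in> {1..m - 1} \<Longrightarrow> 0 < R i"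
    and "coupled_splitting \<xi> zA z T m N0 R Z Zt eps N nrm
           (path_law M X) (\<lambda>x. path_law M (Y x)) K"
  shows "integrable N (splitting_run.estimator \<xi> zA z T m N0 R Z (\<lambda>u. Zt u eps)) \<and>
    prob_space.expectation N (splitting_run.estimator \<xi> zA z T m N0 R Z (\<lambda>u. Zt u eps)) =
    measure M {\<omega> \<in> space M.
      hitting_time (upper_set \<xi> z m) (X \<omega>) < hitting_time (lower_set \<xi> zA) (X \<omega>)}"
proof -
  interpret M: prob_space M by fact
  interpret Mc: complete_measure M by fact
  interpret run: coupled_splitting \<xi> zA z T m N0 R Z Zt eps N nrm "path_law M X" "\<lambda>x. path_law M (Y x)" K
    by fact
  let ?U = "\<lambda>h \<omega>. quadruple \<xi> zA z T h (X \<omega>) (Xt eps \<omega>)"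
  let ?tA = "\<lambda>\<omega>. hitting_time (lower_set \<xi> zA) (X \<omega>)"
  let ?tB = "\<lambda>i \<omega>. hitting_time (upper_set \<xi> z i) (X \<omega>)"
  have X: "continuous_process M X"
    using \<open>strong_solution M W \<mu> \<sigma> X\<close> by (simp add: strong_solution_def Let_def)
  have start: "measure N {\<omega> \<in> space N. run.V 0 [j] \<omega> \<in> C} = measure M {\<omega> \<in> space M. ?U 0 \<omega> \<in> C}"
    if "j < N0" "C \<in> sets borel" for j C
    unfolding run.V_def measure_quadruple_0[OF run.continuous_paths that(2)]
      measure_quadruple_0[OF X that(2)] run.initial_law[OF that(1)] ..
  have levels: "zA < z i" "z i \<le> z m" if "i \<in> {1..m}" for i
    using level_mono[of m z 1 i] level_mono[of m z i m] that assms(13,14) by fastforce+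
  have crossed_iff: "(\<forall>i\<in>{1..m}. ?tB i \<omega> < ?tA \<omega>) \<longleftrightarrow> ?tB m \<omega> < ?tA \<omega>" for \<omega>
  proof
    assume "?tB m \<omega> < ?tA \<omega>"
    moreover have "?tB i \<omega> \<le> ?tB m \<omega>" if "i \<in> {1..m}" for i
      using levels(2)[OF that] by (intro hitting_time_mono) (auto simp: upper_set_def)
    ultimately show "\<forall>i\<in>{1..m}. ?tB i \<omega> < ?tA \<omega>" by (blast intro: le_less_trans)
  qed (use \<open>1 \<le> m\<close> in auto)
  have "AE \<omega> in M. continuous_on {0..} (X \<omega>)"
    using X by (simp add: continuous_process_def)
  then have "AE \<omega> in M. (\<forall>h\<in>{1..m}. potential \<xi> z h (?U h \<omega>) = 1) \<longleftrightarrow> ?tB m \<omega> < ?tA \<omega>"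
  proof eventually_elim
    case (elim \<omega>)
    then show ?case
      using potential_quadruple_eq_1_iff[OF elim \<open>continuous_on UNIV \<xi>\<close>] levels(1)
      by (simp flip: crossed_iff)
  qed
  then have ae: "AE \<omega> in M. \<omega> \<in> {\<omega> \<in> space M. ?tB m \<omega> < ?tA \<omega>} \<longleftrightarrow>
      \<omega> \<in> {\<omega> \<in> space M. \<forall>h\<in>{1..m}. potential \<xi> z h (?U h \<omega>) = 1}"
    by eventually_elim auto
  have crossing: "{\<omega> \<in> space M. ?tB m \<omega> < ?tA \<omega>} \<in> sets M"
    by (intro borel_measurable_less Mc.borel_measurable_level_times X \<open>continuous_on UNIV \<xi>\<close>)
  have "{\<omega> \<in> space M. \<forall>h\<in>{1..m}. potential \<xi> z h (?U h \<omega>) = 1} \<in> sets M"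
    by (rule Mc.in_sets_AE[OF ae crossing]) blast
  with ae crossing have eq: "measure M {\<omega> \<in> space M. ?tB m \<omega> < ?tA \<omega>} =
      measure M {\<omega> \<in> space M. \<forall>h\<in>{1..m}. potential \<xi> z h (?U h \<omega>) = 1}"
    by (rule M.finite_measure_eq_AE)
  show ?thesis
    unfolding eq
    by (intro conjI run.expectation_estimator[where M = M and U = ?U] assms M.prob_space_axioms start)
qed

end
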